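(* Let $L$ be an integrally closed lattice domain. Then $L$ is divisorial if and only if $L$ is Prüfer, $L$ is h-local, and all maximal elements of $L$ are principal.
   Context: A multiplicative lattice is a complete lattice $(L,\le)$ with bottom element $0$ and top element $1$, which is also a commutative monoid with identity $1$, such that $a(\bigvee_\alpha b_\alpha)=\bigvee_\alpha(ab_\alpha)$ for all $a,b_\alpha\in L$. An element $c\in L$ is compact if $S\subseteq L$ and $c\le\bigvee S$ imply $c\le\bigvee T$ for some finite $T\subseteq S$. For $x,y\in L$, $(y:x)=\bigvee\{a\in L \mid ax\le y\}$. An element $x\in L$ is principal if it satisfies both $y\wedge zx=((y:x)\wedge z)x$ and $y\vee(z:x)=((yx\vee z):x)$ for all $y,z\in L$. $L$ is principally generated if every element is a join of principal elements; $L$ is a $C$-lattice if $1$ is compact, the set of compact elements is closed under multiplication, and every element is a join of compact elements. Throughout, "lattice" means a multiplicative lattice which is a principally generated $C$-lattice. An element $p\in L\setminus\{1\}$ is prime if $xy\le p$ (with $x,y\in L$) implies $x\le p$ or $y\le p$. A maximal element is a maximal element of $L\setminus\{1\}$. A lattice domain is a lattice in which $0$ is a prime element. Divisorial closure: for a lattice domain $L$ and $a\in L\setminus\{0\}$, $a_v:=(x:(x:a))$ for some nonzero principal element $x\le a$ (the result does not depend on the choice of $x$). The element $a$ is divisorial if $a=a_v$; also $0$ is declared divisorial. A lattice domain $L$ is divisorial if all its elements are divisorial. A lattice domain $L$ is integrally closed if $(xc:c)=x$ for each nonzero principal element $x$ and each nonzero compact element $c$ of $L$. A lattice domain is Prüfer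 (a Prüfer lattice) if all its compact elements are principal. A lattice domain $L$ is h-local if (i) every nonzero prime element of $L$ is below a unique maximal element, and (ii) for every $b\in L\setminus\{0\}$, the set of maximal elements above $b$ (i.e. $\ge b$) is finite. *)

theory Defs
  imports Main
begin

text \<open>
  The element called 0 in the literature is the lattice bottom \<^const>\<open>bot\<close>; no separate
  constant is introduced for it. The case \<open>B = {}\<close> of \<open>mult_Sup\<close> says that it is absorbing.
\<close>

class multiplicative_lattice = complete_lattice + comm_monoid_mult +
  assumes one_eq_top: "1 = top"
    and mult_Sup: "a * Sup B = Sup ((\<lambda>b. a * b) ` B)"
begin

definition compact_element :: "'a \<Rightarrow> bool" where
  "compact_element c \<longleftrightarrow> (\<forall>S. c \<le> Sup S \<longrightarrow> (\<exists>T. T \<subseteq> S \<and> finite T \<and> c \<le> Sup T))"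

text \<open>\<open>residual y x\<close> is usually written \<open>(y : x)\<close>.\<close>

definition residual :: "'a \<Rightarrow> 'a \<Rightarrow> 'a" where
  "residual y x = Sup {a. a * x \<le> y}"

definition principal_element :: "'a \<Rightarrow> bool" where
  "principal_element x \<longleftrightarrow>
     (\<forall>y z. inf y (z * x) = inf (residual y x) z * x \<and>
            sup y (residual z x) = residual (sup (y * x) z) x)"

definition prime_element :: "'a \<Rightarrow> bool" where
  "prime_element p \<longleftrightarrow> p \<noteq> 1 \<and> (\<forall>x y. x * y \<le> p \<longrightarrow> x \<le> p \<or> y \<le> p)"

definition maximal_element :: "'a \<Rightarrow> bool" where
  "maximal_element m \<longleftrightarrow> m \<noteq> 1 \<and> (\<forall>x. x \<noteq> 1 \<longrightarrow> m \<le> x \<longrightarrow> x = m)"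

end

class principally_generated_C_lattice = multiplicative_lattice +
  assumes principally_generated: "\<exists>S. (\<forall>s\<in>S. principal_element s) \<and> a = Sup S"
    and compact_one: "compact_element 1"
    and compact_mult: "compact_element c \<Longrightarrow> compact_element d \<Longrightarrow> compact_element (c * d)"
    and compactly_generated: "\<exists>S. (\<forall>s\<in>S. compact_element s) \<and> a = Sup S"

class lattice_domain = principally_generated_C_lattice +
  assumes prime_bot: "prime_element bot"
begin

text \<open>
  The value at a nonzero element does not depend on the chosen \<open>x\<close>, see \<open>v_closure_eq\<close> below.
  At \<^const>\<open>bot\<close> there is no admissible \<open>x\<close> and the value is unspecified.
\<close>

definition v_closure :: "'a \<Rightarrow> 'a" where
  "v_closure a =
     (let x = (SOME x. x \<noteq> bot \<and> principal_element x \<and> x \<le> a)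
      in residual x (residual x a))"

definition divisorial_element :: "'a \<Rightarrow> bool" where
  "divisorial_element a \<longleftrightarrow> a = bot \<or> a = v_closure a"

lemma mult_mono_right: "b \<le> c \<Longrightarrow> a * b \<le> a * c"
  using mult_Sup[of a "{b, c}"] by (simp add: sup.absorb2 le_iff_sup)

lemma residual_iff: "b \<le> residual y x \<longleftrightarrow> b * x \<le> y"
proof
  assume "b \<le> residual y x"
  then have "x * b \<le> x * residual y x" by (rule mult_mono_right)
  also have "\<dots> \<le> y"
    unfolding residual_def mult_Sup by (rule Sup_least) (auto simp: mult.commute)
  finally show "b * x \<le> y" by (simp add: mult.commute)
qed (auto simp: residual_def intro: Sup_upper)

lemma mult_bot: "a * bot = bot"
  using mult_Sup[of a "{}"] by simp

lemma principal_cancel: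
  assumes "principal_element x" "x \<noteq> bot"
  shows "b * x \<le> c * x \<longleftrightarrow> b \<le> c"
proof -
  have "residual bot x = bot"
  proof -
    have "residual bot x * x \<le> bot" using residual_iff by blast
    then have "residual bot x \<le> bot \<or> x \<le> bot"
      using prime_bot unfolding prime_element_def by blast
    then show ?thesis using assms(2) by (simp add: bot_unique)
  qed
  then have "residual (c * x) x = c"
    using assms(1) unfolding principal_element_def by (metis sup_bot_right)
  then show ?thesis using residual_iff by metis
qed

lemma residual_mult_eq:
  assumes "principal_element y" "y \<noteq> bot" "principal_element x" "x \<noteq> bot" "x \<le> a"
  shows "residual (x * y) (residual (x * y) a) = residual x (residual x a)"
proof -
  have 1: "residual (x * y) a = residual x a * y"
  proof (rule order.antisym)
    let ?b = "residual (x * y) a"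
    have "?b * x \<le> ?b * a" using assms(5) by (rule mult_mono_right)
    also have "\<dots> \<le> x * y" using residual_iff by blast
    finally have "?b \<le> y"
      using principal_cancel[OF assms(3,4), of ?b y] by (simp add: mult.commute)
    then have "inf ?b (1 * y) = ?b" by (simp add: inf.absorb1)
    then obtain c where c: "?b = c * y"
      using assms(1) unfolding principal_element_def by metis
    have "?b * a \<le> x * y" using residual_iff by blast
    then have "(c * a) * y \<le> x * y" by (simp add: c ac_simps)
    then have "c \<le> residual x a"
      using principal_cancel[OF assms(1,2)] residual_iff by blast
    then show "?b \<le> residual x a * y"
      unfolding c using principal_cancel[OF assms(1,2)] by blast
  next
    have "residual x a * a \<le> x" using residual_iff by blast
    then have "residual x a * a * y \<le> x * y"
      using principal_cancel[OF assms(1,2)] by blast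
    then show "residual x a * y \<le> residual (x * y) a"
      by (simp add: residual_iff ac_simps)
  qed
  have "b \<le> residual (x * y) (residual x a * y) \<longleftrightarrow> b \<le> residual x (residual x a)" for b
    unfolding residual_iff
    using principal_cancel[OF assms(1,2), of "b * residual x a" x] by (simp add: ac_simps)
  then show ?thesis unfolding 1 by (meson order.antisym order.refl)
qed

lemma v_closure_eq:
  assumes "principal_element x" "x \<noteq> bot" "x \<le> a"
  shows "v_closure a = residual x (residual x a)"
proof -
  define z where "z = (SOME z. z \<noteq> bot \<and> principal_element z \<and> z \<le> a)"
  have z: "z \<noteq> bot \<and> principal_element z \<and> z \<le> a"
    unfolding z_def by (rule someI[of _ x]) (use assms in blast)
  have "residual z (residual z a) = residual (z * x) (residual (z * x) a)"
    using residual_mult_eq[of x z a] assms z by simp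
  also have "\<dots> = residual x (residual x a)"
    using residual_mult_eq[of z x a] assms z by (simp add: mult.commute)
  finally show ?thesis by (simp add: v_closure_def z_def)
qed

end

definition divisorial_domain :: "'a::lattice_domain itself \<Rightarrow> bool" where
  "divisorial_domain _ \<longleftrightarrow> (\<forall>a::'a. divisorial_element a)"

definition integrally_closed :: "'a::lattice_domain itself \<Rightarrow> bool" where
  "integrally_closed _ \<longleftrightarrow>
     (\<forall>x c :: 'a. x \<noteq> bot \<and> principal_element x \<and> c \<noteq> bot \<and> compact_element c
        \<longrightarrow> residual (x * c) c = x)"

definition Pruefer_lattice :: "'a::lattice_domain itself \<Rightarrow> bool" where
  "Pruefer_lattice _ \<longleftrightarrow> (\<forall>c::'a. compact_element c \<longrightarrow> principal_element c)"

definition h_local :: "'a::lattice_domain itself \<Rightarrow> bool" where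
  "h_local _ \<longleftrightarrow>
     (\<forall>p::'a. prime_element p \<and> p \<noteq> bot \<longrightarrow> (\<exists>!m. maximal_element m \<and> p \<le> m)) \<and>
     (\<forall>b::'a. b \<noteq> bot \<longrightarrow> finite {m. maximal_element m \<and> b \<le> m})"

end

theory Submission
  imports Defs
begin

text \<open>
  Divisoriality is a duality: for a nonzero principal \<open>x\<close>, the map \<open>a \<mapsto> (x : a)\<close> is an
  order-reversing involution on the elements above \<open>x\<close> exactly when all of these are divisorial.

  Suppose \<open>L\<close> is divisorial and integrally closed.
  If \<open>c\<close> is compact, \<open>x \<le> c\<close> is nonzero principal and \<open>a = (x : c)\<close>, then integral closedness
  gives \<open>(x\<^sup>2 : ca) = x\<close>, whose dual is \<open>ca = x\<close>. So \<open>c\<close> divides a principal element and is therefore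
  principal, that is, \<open>L\<close> is a Pruefer lattice (\<open>divisorial_imp_Pruefer\<close>). A nonzero maximal element \<open>m\<close>
  is divisorial, hence equal to \<open>(x : b)\<close> for some compact \<open>b\<close>, and this residual is a factor of \<open>x\<close>
  (\<open>maximal_principal\<close>). The duality turns meets into joins, and the dual of \<open>m\<close> is compact;
  consequently a maximal element above an arbitrary meet of elements with a common nonzero lower
  bound is above one of them (\<open>maximal_completely_prime\<close>). Both halves of h-locality follow from
  this complete primeness.

  Conversely, suppose that \<open>b \<le> a\<^sub>v\<close> is compact but \<open>b \<le> a\<close> fails, and choose a maximal
  \<open>m \<ge> (a : b)\<close>. A Pruefer lattice is locally a chain and \<open>m\<close> is principal, so \<open>a \<le> mb\<close> holds locally
  at \<open>m\<close>. By h-locality one multiplier \<open>s\<close> not below \<open>m\<close> makes this global: \<open>sa \<le> mb\<close>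
  (\<open>h_local_isolate\<close>). Then the fraction \<open>t = sx/(mb)\<close> lies in \<open>(x : a)\<close>, so that \<open>tb \<le> x\<close>,
  which after cancellation says \<open>s \<le> m\<close>, a contradiction.
\<close>

section \<open>Multiplication and residuals\<close>

lemma mult_mono_lattice:
  fixes a b c d :: "'a::multiplicative_lattice"
  assumes "a \<le> b" "c \<le> d"
  shows "a * c \<le> b * d"
proof -
  have mono: "x * y \<le> x * z" if "y \<le> z" for x y z :: 'a
    using that mult_Sup[of x "{y, z}"] by (simp add: sup.absorb2 le_iff_sup)
  have "c * a \<le> c * b" "b * c \<le> b * d" using assms mono by blast+
  then show ?thesis by (simp add: mult.commute)
qed

lemma le_one: "a \<le> (1::'a::multiplicative_lattice)"
  by (simp add: one_eq_top)

lemma one_le_iff: "1 \<le> a \<longleftrightarrow> a = (1::'a::multiplicative_lattice)"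
  using le_one order.antisym by auto

lemma mult_le_left: "a * b \<le> (a::'a::multiplicative_lattice)"
  using mult_mono_lattice[OF order.refl le_one, of a b] by simp

lemma mult_le_right: "a * b \<le> (b::'a::multiplicative_lattice)"
  using mult_le_left[of b a] by (simp add: mult.commute)

lemma mult_sup_left: "a * sup b c = sup (a * b) (a * (c::'a::multiplicative_lattice))"
  using mult_Sup[of a "{b, c}"] by simp

lemma mult_sup_right: "sup b c * a = sup (b * a) (c * (a::'a::multiplicative_lattice))"
  using mult_sup_left[of a b c] by (simp add: mult.commute)

lemma residual_mult_le: "residual y x * x \<le> (y::'a::multiplicative_lattice)"
  unfolding residual_def mult.commute[of _ x] mult_Sup
  by (rule Sup_least) (auto simp: mult.commute)

lemma le_residual_iff: "b \<le> residual y x \<longleftrightarrow> b * x \<le> (y::'a::multiplicative_lattice)"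
proof
  assume "b \<le> residual y x"
  then have "b * x \<le> residual y x * x" by (simp add: mult_mono_lattice)
  then show "b * x \<le> y" using residual_mult_le order.trans by blast
qed (auto simp: residual_def intro: Sup_upper)

lemma le_residual: "y \<le> residual y (x::'a::multiplicative_lattice)"
  by (simp add: le_residual_iff mult_le_left)

lemma residual_antimono:
  "a \<le> b \<Longrightarrow> residual y b \<le> residual y (a::'a::multiplicative_lattice)"
  by (meson mult_mono_lattice order.refl order.trans le_residual_iff residual_mult_le)

lemma le_residual_residual: "a \<le> residual x (residual x (a::'a::multiplicative_lattice))"
  by (metis mult.commute le_residual_iff residual_mult_le)

lemma residual_mult: "residual z (a * b) = residual (residual z b) (a::'a::multiplicative_lattice)"
proof -
  have "d \<le> residual z (a * b) \<longleftrightarrow> d \<le> residual (residual z b) a" for d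
    by (simp add: le_residual_iff mult.assoc)
  then show ?thesis by (meson order.antisym order.refl)
qed

lemma le_residual_Sup_iff:
  fixes x :: "'a::multiplicative_lattice"
  shows "d \<le> residual x (Sup B) \<longleftrightarrow> (\<forall>b\<in>B. d \<le> residual x b)"
  by (simp add: le_residual_iff mult_Sup SUP_le_iff)

section \<open>Principal elements\<close>

lemma principal_divides:
  fixes x :: "'a::multiplicative_lattice"
  assumes "principal_element x" "b \<le> x"
  obtains e where "b = e * x"
proof -
  have "inf b (1 * x) = inf (residual b x) 1 * x"
    using assms(1) unfolding principal_element_def by blast
  then have "b = inf (residual b x) 1 * x" using assms(2) by (simp add: inf.absorb1)
  then show thesis by (rule that)
qed

lemma principal_bot: "principal_element (bot::'a::lattice_domain)"
proof -
  have "residual y bot = (top::'a)" for y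
    by (rule top_le) (simp add: le_residual_iff mult_bot)
  then show ?thesis by (simp add: principal_element_def mult_bot)
qed

lemma principal_mult:
  fixes a b :: "'a::multiplicative_lattice"
  assumes "principal_element a" "principal_element b"
  shows "principal_element (a * b)"
  unfolding principal_element_def
proof (intro allI conjI)
  fix y z :: 'a
  have "inf y (z * (a * b)) = inf y ((z * a) * b)" by (simp add: mult.assoc)
  also have "\<dots> = inf (residual y b) (z * a) * b"
    using assms(2) unfolding principal_element_def by blast
  also have "inf (residual y b) (z * a) = inf (residual (residual y b) a) z * a"
    using assms(1) unfolding principal_element_def by blast
  finally show "inf y (z * (a * b)) = inf (residual y (a * b)) z * (a * b)"
    by (simp add: mult.assoc residual_mult)
  have "sup y (residual z (a * b)) = sup y (residual (residual z b) a)"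
    by (simp add: residual_mult)
  also have "\<dots> = residual (sup (y * a) (residual z b)) a"
    using assms(1) unfolding principal_element_def by blast
  also have "sup (y * a) (residual z b) = residual (sup (y * a * b) z) b"
    using assms(2) unfolding principal_element_def by blast
  finally show "sup y (residual z (a * b)) = residual (sup (y * (a * b)) z) (a * b)"
    by (simp add: mult.assoc residual_mult)
qed

lemma domain_mult_eq_bot:
  fixes a b :: "'a::lattice_domain"
  shows "a * b = bot \<Longrightarrow> a = bot \<or> b = bot"
  using prime_bot unfolding prime_element_def by (metis bot_unique order.refl)

text \<open>
  A factor \<open>c\<close> of a principal element inherits cancellation, and each of the two defining
  identities for \<open>c\<close> becomes the one for \<open>c * a\<close> after multiplication by the cofactor \<open>a\<close>.
\<close>

lemma principal_factor:
  fixes c a :: "'a::lattice_domain"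
  assumes pr: "principal_element (c * a)" and nz: "c * a \<noteq> bot"
  shows "principal_element c"
proof -
  have cancel_a: "d \<le> e" if "d * a \<le> e * a" for d e
  proof -
    have "c * (d * a) \<le> c * (e * a)" using that by (rule mult_mono_right)
    then have "d * (c * a) \<le> e * (c * a)" by (simp add: ac_simps)
    then show ?thesis using principal_cancel[OF pr nz] by blast
  qed
  have cancel_c: "d \<le> e" if "d * c \<le> e * c" for d e
  proof -
    have "a * (d * c) \<le> a * (e * c)" using that by (rule mult_mono_right)
    then have "d * (c * a) \<le> e * (c * a)" by (simp add: ac_simps)
    then show ?thesis using principal_cancel[OF pr nz] by blast
  qed
  have divides: "\<exists>e. b = e * c" if "b \<le> c" for b
  proof -
    have "b * a \<le> c * a" using that by (simp add: mult_mono_lattice)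
    then obtain e where "b * a = e * (c * a)" using principal_divides[OF pr] by blast
    then have "b * a = (e * c) * a" by (simp add: ac_simps)
    then have "b = e * c" using cancel_a by (metis order.antisym order.refl)
    then show ?thesis by blast
  qed
  show ?thesis unfolding principal_element_def
  proof (intro allI conjI)
    fix y z :: 'a
    show "inf y (z * c) = inf (residual y c) z * c"
    proof (rule order.antisym)
      have "inf y (z * c) \<le> c" by (rule le_infI2) (rule mult_le_right)
      then obtain e where e: "inf y (z * c) = e * c" using divides by blast
      have "e * c \<le> y" "e * c \<le> z * c" unfolding e[symmetric] by simp_all
      then have "e \<le> inf (residual y c) z" using cancel_c by (simp add: le_residual_iff)
      then show "inf y (z * c) \<le> inf (residual y c) z * c"
        unfolding e by (simp add: mult_mono_lattice)
      have "inf (residual y c) z * c \<le> residual y c * c"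
        by (simp add: mult_mono_lattice)
      then have "inf (residual y c) z * c \<le> y" using residual_mult_le order.trans by blast
      then show "inf (residual y c) z * c \<le> inf y (z * c)"
        by (simp add: mult_mono_lattice)
    qed
    show "sup y (residual z c) = residual (sup (y * c) z) c"
    proof (rule order.antisym)
      show "sup y (residual z c) \<le> residual (sup (y * c) z) c"
        by (simp add: le_residual_iff mult_sup_right residual_mult_le le_supI2)
      let ?e = "residual (sup (y * c) z) c"
      have "(?e * c) * a \<le> sup (y * c) z * a"
        by (simp add: mult_mono_lattice residual_mult_le)
      then have "?e * (c * a) \<le> sup (y * (c * a)) (z * a)"
        by (simp add: mult_sup_right mult.assoc)
      then have "?e \<le> residual (sup (y * (c * a)) (z * a)) (c * a)"
        by (simp add: le_residual_iff)
      also have "\<dots> = sup y (residual (z * a) (c * a))"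
        using pr unfolding principal_element_def by metis
      also have "\<dots> \<le> sup y (residual z c)"
      proof -
        have "residual (z * a) (c * a) \<le> residual z c"
          using residual_mult_le[of "z * a" "c * a"]
          by (simp add: le_residual_iff mult.assoc[symmetric] cancel_a)
        then show ?thesis by (simp add: le_supI2)
      qed
      finally show "?e \<le> sup y (residual z c)" .
    qed
  qed
qed

section \<open>Compact, prime and maximal elements\<close>

lemma le_if_compact_le:
  fixes a b :: "'a::principally_generated_C_lattice"
  assumes "\<And>c. compact_element c \<Longrightarrow> c \<le> a \<Longrightarrow> c \<le> b"
  shows "a \<le> b"
proof -
  obtain S where "\<forall>s\<in>S. compact_element s" "a = Sup S" using compactly_generated by blast
  then show ?thesis using assms by (simp add: Sup_le_iff Sup_upper)
qed

lemma nonzero_principal_below: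
  fixes a :: "'a::principally_generated_C_lattice"
  assumes "a \<noteq> bot"
  obtains x where "principal_element x" "x \<noteq> bot" "x \<le> a"
proof -
  obtain S where S: "\<forall>s\<in>S. principal_element s" "a = Sup S"
    using principally_generated by blast
  then have "\<not> (\<forall>s\<in>S. s = bot)" using assms by auto
  then show thesis using S that Sup_upper by blast
qed

lemma nonzero_compact_below:
  fixes a :: "'a::principally_generated_C_lattice"
  assumes "a \<noteq> bot"
  obtains x where "compact_element x" "x \<noteq> bot" "x \<le> a"
  using assms le_if_compact_le[of a bot] bot_unique by blast

lemma compact_sup:
  fixes a b :: "'a::multiplicative_lattice"
  assumes "compact_element a" "compact_element b"
  shows "compact_element (sup a b)"
  unfolding compact_element_def
proof (intro allI impI)
  fix S assume "sup a b \<le> Sup S"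
  then obtain T U where "T \<subseteq> S" "finite T" "a \<le> Sup T" "U \<subseteq> S" "finite U" "b \<le> Sup U"
    using assms unfolding compact_element_def by (meson le_supE)
  then have "T \<union> U \<subseteq> S \<and> finite (T \<union> U) \<and> sup a b \<le> Sup (T \<union> U)"
    by (auto simp: Sup_union_distrib intro: le_supI1 le_supI2)
  then show "\<exists>T. T \<subseteq> S \<and> finite T \<and> sup a b \<le> Sup T" by blast
qed

lemma compact_factor:
  fixes e m :: "'a::lattice_domain"
  assumes c: "compact_element (e * m)" and m: "principal_element m" "m \<noteq> bot"
  shows "compact_element e"
  unfolding compact_element_def
proof (intro allI impI)
  fix S assume "e \<le> Sup S"
  then have "e * m \<le> Sup ((\<lambda>b. m * b) ` S)"
    unfolding mult_Sup[symmetric] by (simp add: mult.commute[of e] mult_mono_right)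
  then obtain T where "T \<subseteq> S" "finite T" "e * m \<le> Sup ((\<lambda>b. m * b) ` T)"
    using c unfolding compact_element_def by (metis finite_subset_image)
  then have "e * m \<le> Sup T * m" by (simp add: mult_Sup mult.commute)
  then have "e \<le> Sup T" using principal_cancel[OF m] by blast
  then show "\<exists>T. T \<subseteq> S \<and> finite T \<and> e \<le> Sup T" using \<open>T \<subseteq> S\<close> \<open>finite T\<close> by blast
qed

lemma compact_le_Sup_chain:
  fixes n :: "'a::multiplicative_lattice"
  assumes "compact_element n" "n \<le> Sup C" "C \<noteq> {}"
    and chain: "\<And>a b. a \<in> C \<Longrightarrow> b \<in> C \<Longrightarrow> a \<le> b \<or> b \<le> a"
  shows "\<exists>a\<in>C. n \<le> a"
proof -
  obtain T where T: "T \<subseteq> C" "finite T" "n \<le> Sup T"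
    using assms(1,2) unfolding compact_element_def by blast
  have "\<exists>u\<in>C. \<forall>t\<in>T. t \<le> u"
    using T(2,1)
  proof (induction T)
    case empty
    then show ?case using assms(3) by auto
  next
    case (insert t T)
    then obtain u where u: "u \<in> C" "\<forall>t\<in>T. t \<le> u" by auto
    show ?case
    proof (cases "t \<le> u")
      case True
      then show ?thesis using u by auto
    next
      case False
      then have "u \<le> t" using chain[of t u] u insert by auto
      then show ?thesis using u insert by (auto intro: order.trans)
    qed
  qed
  then obtain u where "u \<in> C" "Sup T \<le> u" by (auto simp: Sup_le_iff)
  then show ?thesis using T(3) order.trans by blast
qed

text \<open>
  Compactness of the elements of \<open>N\<close> makes avoidance of \<open>N\<close> stable under joins of chains, so
  Zorn's lemma applies. The case \<open>N = {1}\<close> gives maximal elements; multiplicatively closed \<open>N\<close> give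
  primes.
\<close>

lemma maximal_avoiding:
  fixes x :: "'a::multiplicative_lattice"
  assumes N: "\<forall>n\<in>N. compact_element n" and x: "\<forall>n\<in>N. \<not> n \<le> x"
  obtains p where "x \<le> p" "\<forall>n\<in>N. \<not> n \<le> p" "\<And>q. p \<le> q \<Longrightarrow> \<forall>n\<in>N. \<not> n \<le> q \<Longrightarrow> q = p"
proof -
  define A where "A = {z. x \<le> z \<and> (\<forall>n\<in>N. \<not> n \<le> z)}"
  have "\<exists>p\<in>A. \<forall>q\<in>A. p \<le> q \<longrightarrow> q = p"
  proof (rule predicate_Zorn)
    show "partial_order_on A (relation_of (\<le>) A)"
      by (rule partial_order_on_relation_ofI) auto
  next
    fix C assume C: "C \<in> Chains (relation_of (\<le>) A)"
    have sub: "C \<subseteq> A" and chain: "\<And>a b. a \<in> C \<Longrightarrow> b \<in> C \<Longrightarrow> a \<le> b \<or> b \<le> a"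
      using C by (auto simp: Chains_def relation_of_def)
    show "\<exists>u\<in>A. \<forall>a\<in>C. a \<le> u"
    proof (cases "C = {}")
      case True
      have "x \<in> A" using x by (simp add: A_def)
      then show ?thesis using True by blast
    next
      case False
      then obtain c where "c \<in> C" by blast
      then have "x \<le> Sup C" using sub by (auto simp: A_def intro: Sup_upper2)
      moreover have "\<not> n \<le> Sup C" if "n \<in> N" for n
      proof
        assume "n \<le> Sup C"
        moreover have "compact_element n" using N that by blast
        ultimately have "\<exists>a\<in>C. n \<le> a" using compact_le_Sup_chain False chain by blast
        then show False using sub that by (auto simp: A_def)
      qed
      ultimately have "Sup C \<in> A" by (simp add: A_def)
      then show ?thesis using Sup_upper by blast
    qed
  qed
  then obtain p where p: "p \<in> A" "\<forall>q\<in>A. p \<le> q \<longrightarrow> q = p" by blast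
  show thesis
  proof (rule that)
    show "x \<le> p" "\<forall>n\<in>N. \<not> n \<le> p" using p(1) by (auto simp: A_def)
    fix q assume "p \<le> q" "\<forall>n\<in>N. \<not> n \<le> q"
    moreover have "x \<le> q" using \<open>p \<le> q\<close> p(1) by (auto simp: A_def)
    ultimately show "q = p" using p(2) by (auto simp: A_def)
  qed
qed

lemma maximal_above:
  fixes a :: "'a::principally_generated_C_lattice"
  assumes "a \<noteq> 1"
  obtains m where "maximal_element m" "a \<le> m"
proof -
  have "\<forall>n\<in>{1::'a}. compact_element n" "\<forall>n\<in>{1}. \<not> n \<le> a"
    using compact_one assms by (simp_all add: one_le_iff)
  then obtain p where "a \<le> p" "\<forall>n\<in>{1}. \<not> n \<le> p" "\<And>q. p \<le> q \<Longrightarrow> \<forall>n\<in>{1}. \<not> n \<le> q \<Longrightarrow> q = p"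
    by (rule maximal_avoiding) blast
  then have "maximal_element p" by (simp add: maximal_element_def one_le_iff)
  then show thesis using \<open>a \<le> p\<close> that by blast
qed

lemma prime_avoiding:
  fixes x :: "'a::multiplicative_lattice"
  assumes N: "\<forall>n\<in>N. compact_element n" "N \<noteq> {}" and x: "\<forall>n\<in>N. \<not> n \<le> x"
    and closed: "\<And>a b. a \<in> N \<Longrightarrow> b \<in> N \<Longrightarrow> a * b \<in> N"
  obtains p where "prime_element p" "x \<le> p" "\<forall>n\<in>N. \<not> n \<le> p"
proof -
  obtain p where p: "x \<le> p" "\<forall>n\<in>N. \<not> n \<le> p" "\<And>q. p \<le> q \<Longrightarrow> \<forall>n\<in>N. \<not> n \<le> q \<Longrightarrow> q = p"
    using maximal_avoiding[OF N(1) x] by blast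
  have "p \<noteq> 1" using p(2) N(2) le_one by blast
  moreover have "u \<le> p \<or> v \<le> p" if uv: "u * v \<le> p" for u v
  proof (rule ccontr)
    assume "\<not> ?thesis"
    then have "sup p u \<noteq> p" "sup p v \<noteq> p" by (auto simp: sup.absorb_iff1)
    then obtain a b where ab: "a \<in> N" "a \<le> sup p u" "b \<in> N" "b \<le> sup p v"
      using p(3)[of "sup p u"] p(3)[of "sup p v"] by auto
    have "a * b \<le> sup p u * sup p v" using ab by (simp add: mult_mono_lattice)
    also have "\<dots> \<le> p"
      using uv by (simp add: mult_sup_left mult_sup_right mult_le_left mult_le_right)
    finally show False using p(2) closed ab by blast
  qed
  ultimately have "prime_element p" by (simp add: prime_element_def)
  then show thesis using p that by blast
qed

lemma maximal_sup_eq_one: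
  fixes m :: "'a::multiplicative_lattice"
  assumes "maximal_element m" "\<not> a \<le> m"
  shows "sup m a = 1"
proof (rule ccontr)
  assume "sup m a \<noteq> 1"
  then have "sup m a = m" using assms(1) by (simp add: maximal_element_def)
  then show False using assms(2) by (simp add: sup.absorb_iff1)
qed

lemma maximal_prime:
  fixes m :: "'a::multiplicative_lattice"
  assumes m: "maximal_element m"
  shows "prime_element m"
  unfolding prime_element_def
proof (intro conjI allI impI)
  show "m \<noteq> 1" using m by (simp add: maximal_element_def)
  fix u v assume uv: "u * v \<le> m"
  show "u \<le> m \<or> v \<le> m"
  proof (rule ccontr)
    assume "\<not> ?thesis"
    then have "sup m u * sup m v = 1" using maximal_sup_eq_one[OF m] by simp
    moreover have "sup m u * sup m v \<le> m"
      using uv by (simp add: mult_sup_left mult_sup_right mult_le_left mult_le_right)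
    ultimately show False using m by (simp add: maximal_element_def one_le_iff)
  qed
qed

lemma prime_mult_not_le:
  "prime_element p \<Longrightarrow> \<not> a \<le> p \<Longrightarrow> \<not> b \<le> p \<Longrightarrow> \<not> a * b \<le> (p::'a::multiplicative_lattice)"
  unfolding prime_element_def by blast

lemma prime_finite_Inf:
  fixes p :: "'a::multiplicative_lattice"
  assumes p: "prime_element p" and "finite T" "Inf T \<le> p"
  shows "\<exists>t\<in>T. t \<le> p"
  using assms(2,3)
proof (induction T)
  case empty
  then have "p = 1" by (simp add: one_eq_top top_unique)
  then show ?case using p by (simp add: prime_element_def)
next
  case (insert t T)
  have "t * Inf T \<le> Inf (insert t T)" by (simp add: mult_le_left mult_le_right)
  then have "t * Inf T \<le> p" using insert.prems by (rule order.trans)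
  then have "t \<le> p \<or> Inf T \<le> p" using p by (simp add: prime_element_def)
  then show ?case using insert.IH by blast
qed

lemma maximal_le_maximal:
  "maximal_element m \<Longrightarrow> maximal_element n \<Longrightarrow> m \<le> n \<Longrightarrow> m = n"
  unfolding maximal_element_def by metis

section \<open>Consequences of divisoriality\<close>

lemma divisorial_double_residual:
  fixes a :: "'a::lattice_domain"
  assumes "divisorial_domain TYPE('a)" "principal_element x" "x \<noteq> bot" "x \<le> a"
  shows "residual x (residual x a) = a"
proof -
  have "a \<noteq> bot" using assms by (auto simp: bot_unique)
  then have "a = v_closure a"
    using assms(1) unfolding divisorial_domain_def divisorial_element_def by blast
  then show ?thesis using v_closure_eq[OF assms(2-4)] by simp
qed

text \<open>
  In terms of fractional ideals, \<open>(cc\<^sup>-\<^sup>1)\<^sup>-\<^sup>1 = (c\<^sub>v : c\<^sub>v) = (c : c) = 1\<close>, where the last step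
  is integral closedness. Dualizing once more gives \<open>cc\<^sup>-\<^sup>1 = 1\<close>. Here \<open>c\<^sup>-\<^sup>1\<close> is represented by
  \<open>a = (x : c)\<close>, with \<open>x \<le> c\<close> as common denominator.
\<close>

lemma divisorial_imp_Pruefer:
  assumes ic: "integrally_closed TYPE('a::lattice_domain)" and div: "divisorial_domain TYPE('a)"
  shows "Pruefer_lattice TYPE('a)"
  unfolding Pruefer_lattice_def
proof (intro allI impI)
  fix c :: 'a assume c: "compact_element c"
  show "principal_element c"
  proof (cases "c = bot")
    case True
    then show ?thesis by (simp add: principal_bot)
  next
    case False
    then obtain x where x: "principal_element x" "x \<noteq> bot" "x \<le> c"
      using nonzero_principal_below by blast
    define a where "a = residual x c"
    have xa: "x \<le> a" unfolding a_def by (rule le_residual)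
    have ca: "c * a \<le> x" unfolding a_def by (metis mult.commute residual_mult_le)
    have dual: "residual x a = c"
      unfolding a_def by (rule divisorial_double_residual[OF div x])
    have "residual (x * x) (c * a) = x"
    proof (rule order.antisym)
      show "x \<le> residual (x * x) (c * a)"
        unfolding le_residual_iff using ca by (rule mult_mono_right)
      let ?b = "residual (x * x) (c * a)"
      have ba: "?b * c * a \<le> x * x" using residual_mult_le by (simp add: mult.assoc)
      have "?b * c * x \<le> ?b * c * a" using xa by (rule mult_mono_right)
      then have "?b * c * x \<le> x * x" using ba by (rule order.trans)
      then have "?b * c \<le> x" using principal_cancel[OF x(1,2)] by blast
      then obtain e where e: "?b * c = e * x" using principal_divides[OF x(1)] by blast
      have "(e * a) * x \<le> x * x" using ba e by (simp add: ac_simps)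
      then have "e * a \<le> x" using principal_cancel[OF x(1,2)] by blast
      then have "e \<le> c" using dual le_residual_iff by blast
      then have "?b * c \<le> x * c"
        unfolding e by (metis mult.commute mult_mono_right)
      then have "?b \<le> residual (x * c) c" by (simp add: le_residual_iff)
      then show "?b \<le> x"
        using ic c False x unfolding integrally_closed_def by simp
    qed
    moreover have "residual (x * x) (residual (x * x) (c * a)) = c * a"
    proof (rule divisorial_double_residual[OF div])
      show "principal_element (x * x)" using x(1) by (simp add: principal_mult)
      show "x * x \<noteq> bot" using x(2) domain_mult_eq_bot by blast
      show "x * x \<le> c * a" using x(3) xa by (rule mult_mono_lattice)
    qed
    moreover have "residual (x * x) x = x"
    proof (rule order.antisym)
      show "residual (x * x) x \<le> x"
        using principal_cancel[OF x(1,2)] residual_mult_le by blast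
    qed (simp add: le_residual_iff)
    ultimately have "c * a = x" by simp
    then show ?thesis using principal_factor[of c a] x by simp
  qed
qed

text \<open>
  Let \<open>x \<le> m\<close> be nonzero and compact. Since \<open>m\<close> is divisorial, some compact \<open>b\<close> not below
  \<open>x\<close> satisfies \<open>bm \<le> x\<close>, and maximality then identifies \<open>m\<close> with the fraction \<open>x/(x \<squnion> b)\<close>, which exists because \<open>x \<squnion> b\<close> is principal.
\<close>

lemma maximal_principal:
  fixes m :: "'a::lattice_domain"
  assumes div: "divisorial_domain TYPE('a)" and pr: "Pruefer_lattice TYPE('a)"
    and m: "maximal_element m"
  shows "principal_element m"
proof (cases "m = bot")
  case True
  then show ?thesis by (simp add: principal_bot)
next
  case False
  have prin: "\<And>c::'a. compact_element c \<Longrightarrow> principal_element c"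
    using pr unfolding Pruefer_lattice_def by blast
  obtain x where x: "compact_element x" "x \<noteq> bot" "x \<le> m"
    using nonzero_compact_below False by blast
  have "\<not> residual x m \<le> x"
  proof
    assume "residual x m \<le> x"
    then have "1 \<le> residual x (residual x m)" by (simp add: le_residual_iff)
    then have "m = 1"
      using divisorial_double_residual[OF div prin[OF x(1)] x(2,3)] by (simp add: one_le_iff)
    then show False using m by (simp add: maximal_element_def)
  qed
  then obtain b where b: "compact_element b" "b \<le> residual x m" "\<not> b \<le> x"
    using le_if_compact_le by blast
  have d: "principal_element (sup x b)" "sup x b \<noteq> bot"
    using prin compact_sup x b by (auto simp: sup_eq_bot_iff)
  obtain e where e: "x = e * sup x b" using principal_divides[OF d(1), of x] by auto
  have "m * sup x b \<le> e * sup x b"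
    unfolding e[symmetric] using b(2)
    by (simp add: mult_sup_left mult_le_right le_residual_iff mult.commute)
  then have "m \<le> e" using principal_cancel[OF d] by blast
  moreover have "e \<noteq> 1" using e b(3) by (metis mult_1 sup.cobounded2)
  ultimately have "e = m" using m by (simp add: maximal_element_def)
  moreover have "principal_element e"
    using principal_factor[of e "sup x b"] prin[OF x(1)] x(2) by (simp flip: e)
  ultimately show ?thesis by simp
qed

text \<open>
  Let \<open>x\<close> be a nonzero compact lower bound of \<open>A\<close>. Dually to \<open>Inf A \<le> m\<close> we have
  \<open>(x : m) \<le> Sup {(x : a) | a \<in> A}\<close>. As \<open>(x : m)\<close> is a factor of the compact element \<open>x\<close>, finitely many \<open>a\<close> suffice on the right; dualizing back, the meet of these
  finitely many is below the prime \<open>m\<close>.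
\<close>

lemma maximal_completely_prime:
  fixes m y :: "'a::lattice_domain"
  assumes div: "divisorial_domain TYPE('a)" and pr: "Pruefer_lattice TYPE('a)"
    and m: "maximal_element m"
    and y: "y \<noteq> bot" "\<And>a. a \<in> A \<Longrightarrow> y \<le> a" and inf: "Inf A \<le> m"
  shows "\<exists>a\<in>A. a \<le> m"
proof -
  obtain x where x: "compact_element x" "x \<noteq> bot" "x \<le> y"
    using nonzero_compact_below y(1) by blast
  have xp: "principal_element x" using x(1) pr unfolding Pruefer_lattice_def by blast
  have xA: "x \<le> a" if "a \<in> A" for a using x(3) y(2)[OF that] by (rule order.trans)
  then have "x \<le> Inf A" by (rule Inf_greatest)
  then have xm: "x \<le> m" using inf by (rule order.trans)
  have dual: "residual x (residual x a) = a" if "x \<le> a" for a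
    by (rule divisorial_double_residual[OF div xp x(2) that])
  have mp: "principal_element m" by (rule maximal_principal[OF div pr m])
  have mnz: "m \<noteq> bot" using xm x(2) by (auto simp: bot_unique)
  have "compact_element (residual x m)"
  proof -
    obtain e where e: "x = e * m" using principal_divides[OF mp xm] by blast
    have "residual x m = e"
    proof (rule order.antisym)
      have "residual x m * m \<le> e * m" using residual_mult_le[of x m] e by simp
      then show "residual x m \<le> e" using principal_cancel[OF mp mnz] by blast
      show "e \<le> residual x m" using e by (simp add: le_residual_iff)
    qed
    moreover have "compact_element e" using compact_factor[OF _ mp mnz] e x(1) by simp
    ultimately show ?thesis by simp
  qed
  moreover have "residual x m \<le> Sup (residual x ` A)"
  proof -
    have "A \<noteq> {}"
      using inf m by (auto simp: maximal_element_def one_eq_top top_unique)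
    then obtain a where "a \<in> A" by blast
    then have "x \<le> Sup (residual x ` A)" using le_residual by (auto intro: Sup_upper2)
    moreover have "residual x (Sup (residual x ` A)) \<le> Inf A"
      using le_residual_Sup_iff[of "residual x (Sup (residual x ` A))" x "residual x ` A"]
        dual xA by (auto intro!: Inf_greatest)
    then have "residual x m \<le> residual x (residual x (Sup (residual x ` A)))"
      using inf by (blast intro: residual_antimono order.trans)
    ultimately show ?thesis using dual by simp
  qed
  ultimately obtain T where T: "T \<subseteq> A" "finite T" "residual x m \<le> Sup (residual x ` T)"
    unfolding compact_element_def by (metis finite_subset_image)
  have "Sup (residual x ` T) \<le> residual x (Inf T)"
    by (auto intro!: Sup_least residual_antimono Inf_lower)
  then have "residual x m \<le> residual x (Inf T)" using T(3) order.trans by blast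
  then have "residual x (residual x (Inf T)) \<le> m"
    using residual_antimono[of _ _ x] dual[OF xm] by metis
  then have "Inf T \<le> m" using le_residual_residual order.trans by blast
  then show ?thesis using prime_finite_Inf[OF maximal_prime[OF m] T(2)] T(1) by blast
qed

text \<open>
  Let \<open>n m\<close> be the meet of the maximal elements above \<open>b\<close> other than \<open>m\<close>. By complete primeness
  \<open>n m\<close> is not below \<open>m\<close>, so no maximal element is above all the \<open>n m\<close>, and already finitely many of
  them join to \<open>1\<close>. A maximal element that is missing from this finite list would be above each of
  them.
\<close>

lemma divisorial_finitely_many_maximal:
  fixes b :: "'a::lattice_domain"
  assumes div: "divisorial_domain TYPE('a)" and pr: "Pruefer_lattice TYPE('a)"
    and b: "b \<noteq> bot"
  shows "finite {m. maximal_element m \<and> b \<le> m}"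
proof (cases "{m. maximal_element m \<and> b \<le> m} = {}")
  case True
  show ?thesis unfolding True by simp
next
  case False
  define M where "M = {m. maximal_element m \<and> b \<le> m}"
  define n where "n = (\<lambda>m. Inf (M - {m}))"
  have "Sup (n ` M) = 1"
  proof (rule ccontr)
    assume "Sup (n ` M) \<noteq> 1"
    then obtain k where k: "maximal_element k" "Sup (n ` M) \<le> k" by (rule maximal_above)
    have nk: "n m \<le> k" if "m \<in> M" for m
      using k(2) that by (simp add: SUP_le_iff)
    obtain m where "m \<in> M" using False by (auto simp: M_def)
    moreover have "b \<le> n m" by (auto simp: n_def M_def intro!: Inf_greatest)
    ultimately have "b \<le> k" using nk order.trans by blast
    then have "k \<in> M" using k(1) by (simp add: M_def)
    then have "Inf (M - {k}) \<le> k" using nk by (simp add: n_def)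
    then have "\<exists>a\<in>M - {k}. a \<le> k"
      using maximal_completely_prime[OF div pr k(1) b, of "M - {k}"]
      by (auto simp: M_def)
    then show False using maximal_le_maximal k(1) by (auto simp: M_def)
  qed
  moreover have "compact_element (1::'a)" by (rule compact_one)
  ultimately obtain T where "T \<subseteq> n ` M" "finite T" "1 \<le> Sup T"
    unfolding compact_element_def by (metis order.refl)
  then obtain F where F: "F \<subseteq> M" "finite F" "1 \<le> Sup (n ` F)"
    by (metis finite_subset_image)
  have "M \<subseteq> F"
  proof
    fix k assume k: "k \<in> M"
    show "k \<in> F"
    proof (rule ccontr)
      assume "k \<notin> F"
      then have "n m \<le> k" if "m \<in> F" for m
        unfolding n_def using k that by (auto intro: Inf_lower)
      then have "Sup (n ` F) \<le> k" by (simp add: SUP_le_iff)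
      then have "1 \<le> k" using F(3) order.trans by blast
      then show False using k by (simp add: M_def maximal_element_def one_le_iff)
    qed
  qed
  then show ?thesis using F(2) finite_subset unfolding M_def by blast
qed

text \<open>
  Suppose \<open>m \<noteq> n\<close>. By complete primeness there is a least element \<open>q \<ge> p\<close> not below \<open>n\<close>. For a compact
  \<open>s \<le> q\<close> not below \<open>n\<close>, the element \<open>p \<squnion> ms\<close> is not below \<open>n\<close> either, so
  \<open>s \<le> q \<le> p \<squnion> ms\<close>. Cancelling the principal element \<open>s\<close> modulo the prime \<open>p\<close> yields
  \<open>1 \<le> p \<squnion> m = m\<close>.
\<close>

lemma divisorial_unique_maximal:
  fixes p :: "'a::lattice_domain"
  assumes div: "divisorial_domain TYPE('a)" and pr: "Pruefer_lattice TYPE('a)"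
    and p: "prime_element p" "p \<noteq> bot"
    and m: "maximal_element m" "p \<le> m" and n: "maximal_element n" "p \<le> n"
  shows "m = n"
proof (rule ccontr)
  assume "m \<noteq> n"
  then have mn: "\<not> m \<le> n" using maximal_le_maximal m(1) n(1) by blast
  define A where "A = {a. p \<le> a \<and> \<not> a \<le> n}"
  have "\<not> Inf A \<le> n"
    using maximal_completely_prime[OF div pr n(1) p(2), of A] by (auto simp: A_def)
  then obtain s where s: "compact_element s" "s \<le> Inf A" "\<not> s \<le> n"
    using le_if_compact_le by blast
  have sp: "principal_element s" using s(1) pr unfolding Pruefer_lattice_def by blast
  have "\<not> m * s \<le> n" by (rule prime_mult_not_le[OF maximal_prime[OF n(1)] mn s(3)])
  then have "sup (m * s) p \<in> A" by (simp add: A_def)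
  then have "s \<le> sup (m * s) p" using s(2) Inf_lower order.trans by blast
  then have "1 \<le> residual (sup (m * s) p) s" by (simp add: le_residual_iff)
  also have "\<dots> = sup m (residual p s)"
    using sp unfolding principal_element_def by metis
  also have "\<dots> \<le> m"
  proof -
    have "\<not> s \<le> p" using s(3) n(2) order.trans by blast
    then have "residual p s \<le> p"
      using p(1) residual_mult_le[of p s] unfolding prime_element_def by blast
    then show ?thesis using m(2) by simp
  qed
  finally show False using m(1) by (simp add: one_le_iff maximal_element_def)
qed

lemma divisorial_imp_h_local:
  assumes div: "divisorial_domain TYPE('a::lattice_domain)" and pr: "Pruefer_lattice TYPE('a)"
  shows "h_local TYPE('a)"
  unfolding h_local_def
proof (intro conjI allI impI)
  fix p :: 'a assume p: "prime_element p \<and> p \<noteq> bot"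
  then obtain m where "maximal_element m" "p \<le> m"
    using maximal_above[of p] unfolding prime_element_def by blast
  then show "\<exists>!m. maximal_element m \<and> p \<le> m"
    using divisorial_unique_maximal[OF div pr] p by blast
next
  fix b :: 'a assume "b \<noteq> bot"
  then show "finite {m. maximal_element m \<and> b \<le> m}"
    by (rule divisorial_finitely_many_maximal[OF div pr])
qed

section \<open>Divisoriality of h-local Pruefer lattices\<close>

text \<open>
  Otherwise the products \<open>st\<close> of compact elements with \<open>s\<close> not below \<open>m\<close> and \<open>t\<close> not below \<open>n\<close>
  could be avoided by a prime above \<open>y\<close>, and that nonzero prime would be below both \<open>m\<close> and \<open>n\<close>.
\<close>

lemma h_local_separate:
  fixes m n y :: "'a::lattice_domain"
  assumes hl: "h_local TYPE('a)" and m: "maximal_element m" and n: "maximal_element n"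
    and "m \<noteq> n" and y: "y \<noteq> bot"
  shows "\<exists>s t. \<not> s \<le> m \<and> \<not> t \<le> n \<and> s * t \<le> y"
proof (rule ccontr)
  assume contra: "\<not> ?thesis"
  define N where
    "N = {s * t | s t. compact_element s \<and> compact_element t \<and> \<not> s \<le> m \<and> \<not> t \<le> n}"
  have one: "\<not> 1 \<le> m" "\<not> 1 \<le> n" "compact_element (1::'a)"
    using m n compact_one by (auto simp: one_le_iff maximal_element_def)
  obtain p where p: "prime_element p" "y \<le> p" "\<forall>k\<in>N. \<not> k \<le> p"
  proof (rule prime_avoiding)
    show "\<forall>k\<in>N. compact_element k" by (auto simp: N_def compact_mult)
    show "N \<noteq> {}" using one by (auto simp: N_def)
    show "\<forall>k\<in>N. \<not> k \<le> y" using contra by (auto simp: N_def)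
  next
    fix a b assume "a \<in> N" "b \<in> N"
    then obtain s t u v where st: "a = s * t" "compact_element s" "compact_element t"
        "\<not> s \<le> m" "\<not> t \<le> n"
      and uv: "b = u * v" "compact_element u" "compact_element v" "\<not> u \<le> m" "\<not> v \<le> n"
      by (auto simp: N_def)
    have "a * b = (s * u) * (t * v)" by (simp add: st uv ac_simps)
    moreover have "\<not> s * u \<le> m" "\<not> t * v \<le> n"
      using prime_mult_not_le maximal_prime m n st uv by blast+
    ultimately show "a * b \<in> N" using st uv compact_mult by (auto simp: N_def)
  qed
  have "p \<le> m"
  proof (rule le_if_compact_le)
    fix s assume "compact_element s" "s \<le> p"
    then have "s * 1 \<in> N" if "\<not> s \<le> m" using one that unfolding N_def by blast
    then show "s \<le> m" using p(3) \<open>s \<le> p\<close> by auto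
  qed
  moreover have "p \<le> n"
  proof (rule le_if_compact_le)
    fix t assume "compact_element t" "t \<le> p"
    then have "1 * t \<in> N" if "\<not> t \<le> n" using one that unfolding N_def by blast
    then show "t \<le> n" using p(3) \<open>t \<le> p\<close> by auto
  qed
  moreover have "p \<noteq> bot" using p(2) y by (auto simp: bot_unique)
  ultimately show False using hl p(1) m n \<open>m \<noteq> n\<close> unfolding h_local_def by blast
qed

text \<open>
  The residual \<open>(y : s)\<close> is a stand-in for the contraction of the localization of \<open>y\<close> at \<open>m\<close>:
  one multiplier \<open>s\<close> outside \<open>m\<close> removes \<open>y\<close> from all other maximal elements at once, because
  only finitely many of them are involved.
\<close>

lemma h_local_isolate:
  fixes m y :: "'a::lattice_domain"
  assumes hl: "h_local TYPE('a)" and m: "maximal_element m" and y: "y \<noteq> bot"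
  obtains s where "\<not> s \<le> m" "\<And>n. maximal_element n \<Longrightarrow> n \<noteq> m \<Longrightarrow> \<not> residual y s \<le> n"
proof -
  define M where "M = {n. maximal_element n \<and> y \<le> n} - {m}"
  have "finite M" using hl y unfolding h_local_def M_def by blast
  moreover have "\<forall>n\<in>M. maximal_element n \<and> n \<noteq> m" by (simp add: M_def)
  ultimately have "\<exists>s. \<not> s \<le> m \<and> (\<forall>n\<in>M. \<not> residual y s \<le> n)"
  proof (induction M)
    case empty
    have "\<not> 1 \<le> m" using m by (simp add: one_le_iff maximal_element_def)
    then show ?case by blast
  next
    case (insert k M)
    then obtain s where s: "\<not> s \<le> m" "\<forall>n\<in>M. \<not> residual y s \<le> n" by auto
    obtain u t where u: "\<not> u \<le> m" "\<not> t \<le> k" "u * t \<le> y"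
      using h_local_separate[OF hl m, of k y] insert.prems y by auto
    have "residual y s \<le> residual y (s * u)" by (rule residual_antimono[OF mult_le_left])
    then have "\<not> residual y (s * u) \<le> n" if "n \<in> M" for n
      using s(2) that order.trans by blast
    moreover have "\<not> residual y (s * u) \<le> k"
    proof
      have "t \<le> residual y u" using u(3) by (simp add: le_residual_iff mult.commute)
      also have "\<dots> \<le> residual y (s * u)" by (rule residual_antimono[OF mult_le_right])
      also assume "\<dots> \<le> k"
      finally show False using u(2) by blast
    qed
    ultimately have "\<forall>n\<in>insert k M. \<not> residual y (s * u) \<le> n" by blast
    moreover have "\<not> s * u \<le> m" by (rule prime_mult_not_le[OF maximal_prime[OF m] s(1) u(1)])
    ultimately show ?case by blast
  qed
  then obtain s where s: "\<not> s \<le> m" "\<forall>n\<in>M. \<not> residual y s \<le> n" by blast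
  show thesis
  proof (rule that[OF s(1)])
    fix n assume n: "maximal_element n" "n \<noteq> m"
    show "\<not> residual y s \<le> n"
    proof
      assume le: "residual y s \<le> n"
      then have "y \<le> n" using le_residual order.trans by blast
      then show False using s(2) n le by (simp add: M_def)
    qed
  qed
qed

text \<open>
  This is the valuation property at \<open>m\<close>: if the principal element \<open>c\<close> does not divide \<open>b\<close> locally at \<open>m\<close>,
  then \<open>c\<close> is a proper multiple of \<open>b\<close> there, and hence a multiple of \<open>mb\<close> since \<open>m\<close> is principal.
  Removing the common factor \<open>b \<squnion> c\<close> makes \<open>b\<close> and \<open>c\<close> comaximal.
\<close>

lemma Pruefer_local_comparison:
  fixes b c m :: "'a::lattice_domain"
  assumes pr: "Pruefer_lattice TYPE('a)" and b: "compact_element b" "b \<noteq> bot"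
    and c: "compact_element c" and m: "maximal_element m" "principal_element m"
    and le: "residual c b \<le> m"
  shows "\<not> residual (m * b) c \<le> m"
proof -
  define d where "d = sup c b"
  have d: "principal_element d" "d \<noteq> bot"
    using pr compact_sup[OF c b(1)] b(2) unfolding Pruefer_lattice_def d_def
    by (auto simp: sup_eq_bot_iff)
  obtain u where u: "c = u * d" using principal_divides[OF d(1), of c] by (auto simp: d_def)
  obtain v where v: "b = v * d" using principal_divides[OF d(1), of b] by (auto simp: d_def)
  have "1 * d \<le> sup u v * d"
    unfolding mult_sup_right u[symmetric] v[symmetric] by (simp add: d_def)
  then have uv: "1 \<le> sup u v" using principal_cancel[OF d] by blast
  have "u * b \<le> c" using mult_le_right[of v c] by (simp add: u v ac_simps)
  then have um: "u \<le> m" using le le_residual_iff order.trans by blast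
  then obtain w where w: "u = w * m" using principal_divides[OF m(2)] by blast
  have "v * c = w * (m * b)" by (simp add: u v w ac_simps)
  then have "v \<le> residual (m * b) c" by (simp add: le_residual_iff mult_le_right)
  moreover have "\<not> v \<le> m"
    using um uv m(1) by (metis le_sup_iff maximal_element_def one_le_iff order.trans)
  ultimately show ?thesis using order.trans by blast
qed

lemma h_local_Pruefer_imp_divisorial:
  assumes pr: "Pruefer_lattice TYPE('a::lattice_domain)" and hl: "h_local TYPE('a)"
    and mp: "\<And>m::'a. maximal_element m \<Longrightarrow> principal_element m"
  shows "divisorial_domain TYPE('a)"
  unfolding divisorial_domain_def divisorial_element_def
proof (intro allI)
  fix a :: 'a
  show "a = bot \<or> a = v_closure a"
  proof (cases "a = bot")
    case False
    then obtain x where x: "principal_element x" "x \<noteq> bot" "x \<le> a"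
      by (rule nonzero_principal_below)
    have "residual x (residual x a) \<le> a"
    proof (rule le_if_compact_le, rule ccontr)
      fix b assume b: "compact_element b" "b \<le> residual x (residual x a)" and nle: "\<not> b \<le> a"
      have bp: "principal_element b" using b(1) pr unfolding Pruefer_lattice_def by blast
      have bnz: "b \<noteq> bot" using nle by auto
      have "residual a b \<noteq> 1" using nle residual_mult_le[of a b] by auto
      then obtain m where m: "maximal_element m" "residual a b \<le> m" by (rule maximal_above)
      have mnz: "m \<noteq> bot"
        using m(2) le_residual[of a b] False by (metis bot_unique order.trans)
      have y: "principal_element (m * b)" "m * b \<noteq> bot"
        using principal_mult[OF mp[OF m(1)] bp] domain_mult_eq_bot mnz bnz by blast+
      obtain s where s: "\<not> s \<le> m"
          "\<And>n. maximal_element n \<Longrightarrow> n \<noteq> m \<Longrightarrow> \<not> residual (m * b) s \<le> n"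
        using h_local_isolate[OF hl m(1) y(2)] by blast
      have "a \<le> residual (m * b) s"
      proof (rule le_if_compact_le)
        fix c assume c: "compact_element c" "c \<le> a"
        have "residual c b \<le> residual a b"
          using residual_mult_le[of c b] c(2) by (meson order.trans le_residual_iff)
        then have "\<not> residual (m * b) c \<le> m"
          using Pruefer_local_comparison[OF pr b(1) bnz c(1) m(1) mp[OF m(1)]] m(2)
            order.trans by blast
        \<comment> \<open>The residual by \<open>c * s\<close> escapes \<open>m\<close> because of \<open>c\<close> and all other maximal elements because
          of \<open>s\<close>.\<close>
        moreover have "residual (m * b) c \<le> residual (m * b) (c * s)"
          by (rule residual_antimono) (rule mult_le_left)
        moreover have "residual (m * b) s \<le> residual (m * b) (c * s)"
          by (rule residual_antimono) (rule mult_le_right)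
        ultimately have "residual (m * b) (c * s) = 1"
          using maximal_above[of "residual (m * b) (c * s)"] s(2) by (metis order.trans)
        then have "c * s \<le> m * b" using residual_mult_le[of "m * b" "c * s"] by simp
        then show "c \<le> residual (m * b) s" by (simp add: le_residual_iff)
      qed
      then have sa: "a * s \<le> m * b" by (simp add: le_residual_iff)
      have "x * s \<le> a * s" using x(3) by (simp add: mult_mono_lattice)
      then have "x * s \<le> m * b" using sa by (rule order.trans)
      then obtain t where t: "x * s = t * (m * b)" using principal_divides[OF y(1)] by blast
      have "(t * a) * (m * b) = (t * (m * b)) * a" by (simp add: ac_simps)
      also have "\<dots> = x * (a * s)" unfolding t[symmetric] by (simp add: ac_simps)
      also have "\<dots> \<le> x * (m * b)" using sa by (rule mult_mono_right)
      finally have "t * a \<le> x" using principal_cancel[OF y] by blast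
      then have "b * t \<le> b * residual x a" by (simp add: mult_mono_right le_residual_iff)
      also have "\<dots> \<le> x" using b(2) by (simp add: le_residual_iff)
      finally have "b * t \<le> x" .
      then have "m * (b * t) \<le> m * x" by (rule mult_mono_right)
      moreover have "m * (b * t) = s * x" using t by (simp add: ac_simps)
      ultimately have "s * x \<le> m * x" by simp
      then show False using principal_cancel[OF x(1,2)] s(1) by blast
    qed
    then show ?thesis
      using v_closure_eq[OF x] le_residual_residual by (metis order.antisym)
  qed simp
qed

theorem theorem20:
  assumes "integrally_closed TYPE('a::lattice_domain)"
  shows "divisorial_domain TYPE('a) \<longleftrightarrow>
    Pruefer_lattice TYPE('a) \<and> h_local TYPE('a) \<and>
    (\<forall>m::'a. maximal_element m \<longrightarrow> principal_element m)"
  using divisorial_imp_Pruefer[OF assms] divisorial_imp_h_local maximal_principal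
    h_local_Pruefer_imp_divisorial by blast

end
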